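(* Let $G$ be a finite simple graph on the vertex set $\{x_1,\ldots,x_h\}$ and let $\mathcal{H}=\{H_i : x_i\in V(G)\}$, where $H_i=K_{m_i}$ is the complete graph on the vertex set $\{y_{i,1},\ldots,y_{i,m_i}\}$ with $m_i\ge1$. Then $$G\circ\mathcal{H}=(G\circ\mathcal{H}-\{y_{1,m_1},\ldots,y_{h,m_h}\})^{\pi},\qquad \pi=\{(V(K_{m_i})\cup\{x_i\})\setminus\{y_{i,m_i}\} : 1\le i\le h\},$$ i.e. the clique corona graph $G\circ\mathcal{H}$ is the clique-whiskered graph of $G\circ\mathcal{H}-\{y_{1,m_1},\ldots,y_{h,m_h}\}$ with respect to the clique partition $\pi$, where $y_{i,m_i}$ is the whisker vertex attached to the $i$-th clique.
   Context: For a graph $G$ on $\{x_1,\ldots,x_h\}$ and a family $\mathcal{H}=\{H_i\}$ of non-empty graphs indexed by the vertices $x_i$, the corona graph $G\circ\mathcal{H}$ is the disjoint union of $G$ and the $H_i$ with additional edges joining each $x_i$ to all vertices of $H_i$; it is a clique corona graph if every $H_i$ is complete. A clique is a vertex set inducing a complete subgraph. A clique partition $\pi=\{W_1,\ldots,W_r\}$ of a graph $\Gamma$ is a family of cliques whose disjoint union is $V(\Gamma)$. The clique-whiskered graph $\Gamma^\pi$ has vertex set $V(\Gamma)\cup\{w_1,\ldots,w_r\}$ (new vertices $w_i$) and edge set $E(\Gamma)\cup\bigcup_{i=1}^r\{\{x,w_i\}: x\in W_i\}$. $\Gamma-A$ denotes the induced subgraph on $V(\Gamma)\setminus A$. *)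

theory Defs
  imports "Graph_Theory.Graph_Theory" "HOL-Library.Disjoint_Sets"
begin

text \<open>
  Finite simple graphs are the \<^locale>\<open>pair_graph\<close>s of the AFP entry Graph_Theory: finite,
  loop-free and symmetric, an undirected edge \<open>{u, v}\<close> being the two arcs \<open>(u, v)\<close> and \<open>(v, u)\<close>.
\<close>

text \<open>
  The graphs \<open>G\<close> and \<open>H v\<close> (one for each vertex \<open>v\<close> of \<open>G\<close>) share an ambient vertex type and the
  disjoint union is formed as a plain union. So this is the corona graph only for pairwise disjoint
  vertex sets; this disjointness is a hypothesis wherever \<open>corona\<close> is used.
\<close>

definition corona :: "'a pair_pre_digraph \<Rightarrow> ('a \<Rightarrow> 'a pair_pre_digraph) \<Rightarrow> 'a pair_pre_digraph" where
  "corona G H =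
    \<lparr> pverts = pverts G \<union> (\<Union>v\<in>pverts G. pverts (H v)),
      parcs = parcs G \<union> (\<Union>v\<in>pverts G. parcs (H v))
        \<union> (\<Union>v\<in>pverts G. {v} \<times> pverts (H v) \<union> pverts (H v) \<times> {v}) \<rparr>"

definition del_verts :: "'a pair_pre_digraph \<Rightarrow> 'a set \<Rightarrow> 'a pair_pre_digraph" where
  "del_verts G A = \<lparr> pverts = pverts G - A, parcs = Restr (parcs G) (pverts G - A) \<rparr>"

lemma with_proj_del_verts:
  "with_proj (del_verts G A) = with_proj G \<restriction> (pverts G - A)"
  by (auto simp: del_verts_def with_proj_def induce_subgraph_def)

definition clique :: "'a pair_pre_digraph \<Rightarrow> 'a set \<Rightarrow> bool" where
  "clique G W \<longleftrightarrow> W \<subseteq> pverts G \<and> K\<^bsub>card W\<^esub> (with_proj G \<restriction> W)"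

definition clique_partition :: "'a pair_pre_digraph \<Rightarrow> 'i set \<Rightarrow> ('i \<Rightarrow> 'a set) \<Rightarrow> bool" where
  "clique_partition G I W \<longleftrightarrow>
    finite I \<and> (\<forall>i\<in>I. clique G (W i)) \<and> disjoint_family_on W I \<and> (\<Union>i\<in>I. W i) = pverts G"

text \<open>
  The names \<open>w i\<close> of the whisker vertices are a parameter. They have to be new and pairwise
  distinct, which is what \<open>whisker_vertices\<close> says.
\<close>

definition whisker_vertices :: "'a pair_pre_digraph \<Rightarrow> 'i set \<Rightarrow> ('i \<Rightarrow> 'a) \<Rightarrow> bool" where
  "whisker_vertices G I w \<longleftrightarrow> inj_on w I \<and> w ` I \<inter> pverts G = {}"

definition clique_whiskered ::
  "'a pair_pre_digraph \<Rightarrow> 'i set \<Rightarrow> ('i \<Rightarrow> 'a set) \<Rightarrow> ('i \<Rightarrow> 'a) \<Rightarrow> 'a pair_pre_digraph" where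
  "clique_whiskered G I W w =
    \<lparr> pverts = pverts G \<union> w ` I,
      parcs = parcs G \<union> (\<Union>i\<in>I. W i \<times> {w i} \<union> {w i} \<times> W i) \<rparr>"

end

theory Submission
  imports Defs
begin

text \<open>
  The statement is an instance of a recognition principle for clique-whiskered graphs. Suppose that
  the cliques \<open>W i\<close> partition the vertex set of a graph, and that each \<open>W i\<close> contains a vertex \<open>w i\<close>
  all of whose neighbours lie in \<open>W i\<close>. As \<open>W i\<close> is a clique, the neighbours of \<open>w i\<close> are exactly
  the vertices of \<open>W i - {w i}\<close>. So the graph arises from the one without the vertices \<open>w i\<close> by
  attaching to each remaining clique \<open>W i - {w i}\<close> the whisker vertex \<open>w i\<close>: this is
  \<open>clique_whiskered_del_verts\<close>, and \<open>clique_partition_del_verts\<close> says that the remaining cliques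
  still form a clique partition.

  In a clique corona graph the sets \<open>{v} \<union> V(H v)\<close>, for \<open>v\<close> a vertex of \<open>G\<close>, form a clique partition
  (\<open>clique_partition_corona\<close>), and a vertex of \<open>H v\<close> has no neighbours outside \<open>{v} \<union> V(H v)\<close>
  (\<open>corona_arcs_of_leaf\<close>). Hence any choice of one vertex in each \<open>H v\<close>, such as the last one, gives
  a family of whisker vertices.
\<close>

lemma clique_iff:
  "clique G W \<longleftrightarrow> W \<subseteq> pverts G \<and> finite W \<and>
    (\<forall>u\<in>W. \<forall>v\<in>W. (u, v) \<in> parcs G \<longleftrightarrow> u \<noteq> v)"
proof -
  have "with_proj G \<restriction> W = with_proj \<lparr>pverts = W, parcs = Restr (parcs G) W\<rparr>"
    by (auto simp: with_proj_def induce_subgraph_def)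
  then show ?thesis
    unfolding clique_def by (auto simp: complete_digraph_pair_def)
qed

lemma clique_partition_del_verts:
  assumes "clique_partition G I W"
  shows "clique_partition (del_verts G A) I (\<lambda>i. W i - A)"
proof -
  have "clique (del_verts G A) (W i - A)" if "clique G (W i)" for i
    using that by (auto simp: clique_iff del_verts_def)
  moreover have "disjoint_family_on (\<lambda>i. W i - A) I" if "disjoint_family_on W I"
    using that unfolding disjoint_family_on_def by blast
  ultimately show ?thesis
    using assms by (auto simp: clique_partition_def del_verts_def)
qed

text \<open>
  The last two assumptions say that \<open>w i\<close> has no neighbour outside its clique. No symmetry of the
  graph is assumed, so both directions of an arc are needed.
\<close>

lemma clique_whiskered_del_verts:
  assumes part: "clique_partition G I W"
    and wf: "parcs G \<subseteq> pverts G \<times> pverts G"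
    and w: "\<And>i. i \<in> I \<Longrightarrow> w i \<in> W i"
    and out_arcs: "\<And>i v. i \<in> I \<Longrightarrow> (w i, v) \<in> parcs G \<Longrightarrow> v \<in> W i"
    and in_arcs: "\<And>i v. i \<in> I \<Longrightarrow> (v, w i) \<in> parcs G \<Longrightarrow> v \<in> W i"
  shows "G = clique_whiskered (del_verts G (w ` I)) I (\<lambda>i. W i - {w i}) w"
proof (rule pair_pre_digraph.equality)
  let ?A = "w ` I"
  let ?R = "clique_whiskered (del_verts G ?A) I (\<lambda>i. W i - {w i}) w"
  have arc_iff: "(u, v) \<in> parcs G \<longleftrightarrow> u \<noteq> v" if "i \<in> I" "u \<in> W i" "v \<in> W i" for i u v
    using part that unfolding clique_partition_def clique_iff by blast
  have A: "?A \<subseteq> pverts G"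
    using part w unfolding clique_partition_def by blast
  then show "pverts G = pverts ?R"
    by (auto simp: clique_whiskered_def del_verts_def)
  show "parcs G = parcs ?R"
  proof (intro set_eqI iffI)
    fix e assume e: "e \<in> parcs G"
    obtain u v where uv: "e = (u, v)" by (cases e)
    consider i where "i \<in> I" "u = w i" | i where "i \<in> I" "v = w i" | "u \<notin> ?A" "v \<notin> ?A"
      by blast
    then show "e \<in> parcs ?R"
    proof cases
      case (1 i)
      then have "v \<in> W i - {w i}"
        using e uv out_arcs arc_iff w by blast
      with 1 uv show ?thesis by (auto simp: clique_whiskered_def)
    next
      case (2 i)
      then have "u \<in> W i - {w i}"
        using e uv in_arcs arc_iff w by blast
      with 2 uv show ?thesis by (auto simp: clique_whiskered_def)
    next
      case 3
      with e uv wf show ?thesis by (auto simp: clique_whiskered_def del_verts_def)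
    qed
  next
    fix e assume "e \<in> parcs ?R"
    then consider "e \<in> parcs G" | i v where "i \<in> I" "v \<in> W i - {w i}" "e = (v, w i) \<or> e = (w i, v)"
      by (auto simp: clique_whiskered_def del_verts_def)
    then show "e \<in> parcs G"
      by cases (use arc_iff w in blast)+
  qed
qed simp

lemma whisker_vertices_del_verts:
  assumes "clique_partition G I W" and "\<And>i. i \<in> I \<Longrightarrow> w i \<in> W i"
  shows "whisker_vertices (del_verts G (w ` I)) I w"
proof -
  have "inj_on w I"
    using assms unfolding clique_partition_def disjoint_family_on_def
    by (intro inj_onI) (metis disjoint_iff)
  then show ?thesis
    unfolding whisker_vertices_def del_verts_def by auto
qed

lemma corona_arcs_in_verts:
  fixes G :: "'a pair_pre_digraph"
  assumes "pair_wf_digraph G" and "\<And>v. v \<in> pverts G \<Longrightarrow> pair_wf_digraph (H v)"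
  shows "parcs (corona G H) \<subseteq> pverts (corona G H) \<times> pverts (corona G H)"
proof -
  have "parcs F \<subseteq> pverts F \<times> pverts F" if "pair_wf_digraph F" for F :: "'a pair_pre_digraph"
    using pair_wf_digraph.in_arcsD1[OF that] pair_wf_digraph.in_arcsD2[OF that] by auto
  then have "parcs G \<subseteq> pverts G \<times> pverts G"
    and "\<And>v. v \<in> pverts G \<Longrightarrow> parcs (H v) \<subseteq> pverts (H v) \<times> pverts (H v)"
    using assms by blast+
  then show ?thesis
    unfolding corona_def pair_pre_digraph.simps by blast
qed

text \<open>
  In the next two lemmas the vertices of \<open>G\<close> are enumerated by \<open>x\<close> over an index set \<open>I\<close>, which also
  indexes the clique partition.
\<close>

lemma clique_partition_corona:
  assumes G: "pair_graph G" and x: "bij_betw x I (pverts G)"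
    and complete: "\<And>i. i \<in> I \<Longrightarrow> K\<^bsub>n i\<^esub> (with_proj (H (x i)))"
    and new: "\<And>i. i \<in> I \<Longrightarrow> pverts (H (x i)) \<inter> pverts G = {}"
    and disj: "disjoint_family_on (\<lambda>i. pverts (H (x i))) I"
  shows "clique_partition (corona G H) I (\<lambda>i. pverts (H (x i)) \<union> {x i})"
proof -
  interpret pair_graph G by (rule G)
  have xI: "x ` I = pverts G" and inj: "inj_on x I"
    using x by (auto simp: bij_betw_def)
  have H: "finite (pverts (H (x i)))"
    "parcs (H (x i)) = {(u, v). (u, v) \<in> pverts (H (x i)) \<times> pverts (H (x i)) \<and> u \<noteq> v}"
    if "i \<in> I" for i
    using complete[OF that] by (auto simp: complete_digraph_pair_def)
  have "clique (corona G H) (pverts (H (x i)) \<union> {x i})" if i: "i \<in> I" for i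
    unfolding clique_iff
  proof (intro conjI ballI)
    show "pverts (H (x i)) \<union> {x i} \<subseteq> pverts (corona G H)"
      using i xI by (auto simp: corona_def)
    show "finite (pverts (H (x i)) \<union> {x i})"
      using H(1)[OF i] by simp
    fix u v assume u: "u \<in> pverts (H (x i)) \<union> {x i}" and v: "v \<in> pverts (H (x i)) \<union> {x i}"
    show "(u, v) \<in> parcs (corona G H) \<longleftrightarrow> u \<noteq> v"
    proof
      assume "u \<noteq> v"
      with u v i show "(u, v) \<in> parcs (corona G H)"
        using H(2)[OF i] xI by (auto simp: corona_def)
    next
      have "(u, u) \<notin> parcs G" for u
        using pair_no_loops by fastforce
      moreover have "(u, u) \<notin> parcs (H (x j))" if "j \<in> I" for u j
        using H(2)[OF that] by blast
      moreover have "x j \<notin> pverts (H (x j))" if "j \<in> I" for j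
        using new[OF that] xI that by blast
      ultimately have "(u, u) \<notin> parcs (corona G H)" for u
        by (auto simp: corona_def simp flip: xI)
      then show "(u, v) \<in> parcs (corona G H) \<Longrightarrow> u \<noteq> v" by blast
    qed
  qed
  moreover have "disjoint_family_on (\<lambda>i. pverts (H (x i)) \<union> {x i}) I"
    unfolding disjoint_family_on_def
  proof (intro ballI impI)
    fix i j assume ij: "i \<in> I" "j \<in> I" "i \<noteq> j"
    then have "pverts (H (x i)) \<inter> pverts (H (x j)) = {}" "x i \<noteq> x j"
      using disj inj by (auto simp: disjoint_family_on_def inj_on_def)
    then show "(pverts (H (x i)) \<union> {x i}) \<inter> (pverts (H (x j)) \<union> {x j}) = {}"
      using new xI ij by blast
  qed
  moreover have "finite I"
    using x pair_finite_verts bij_betw_finite by blast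
  moreover have "(\<Union>i\<in>I. pverts (H (x i)) \<union> {x i}) = pverts (corona G H)"
    by (auto simp: corona_def simp flip: xI)
  ultimately show ?thesis
    by (simp add: clique_partition_def)
qed

lemma corona_arcs_of_leaf:
  assumes G: "pair_wf_digraph G" and H: "\<And>i. i \<in> I \<Longrightarrow> pair_wf_digraph (H (x i))"
    and x: "pverts G = x ` I"
    and new: "\<And>i. i \<in> I \<Longrightarrow> pverts (H (x i)) \<inter> pverts G = {}"
    and disj: "disjoint_family_on (\<lambda>i. pverts (H (x i))) I"
    and i: "i \<in> I" and u: "u \<in> pverts (H (x i))"
    and arc: "(u, v) \<in> parcs (corona G H) \<or> (v, u) \<in> parcs (corona G H)"
  shows "v \<in> pverts (H (x i)) \<union> {x i}"
proof -
  have uG: "u \<notin> pverts G"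
    using new i u by blast
  have only: "j = i" if "j \<in> I" "u \<in> pverts (H (x j))" for j
    using disj that i u unfolding disjoint_family_on_def by blast
  have "(u, v) \<notin> parcs G" "(v, u) \<notin> parcs G"
    using uG pair_wf_digraph.in_arcsD1[OF G] pair_wf_digraph.in_arcsD2[OF G] by blast+
  then consider j where "j \<in> I" "(u, v) \<in> parcs (H (x j)) \<or> (v, u) \<in> parcs (H (x j))"
    | j where "j \<in> I" "u \<in> pverts (H (x j))" "v = x j"
    using arc uG x by (auto simp: corona_def)
  then show ?thesis
  proof cases
    case (1 j)
    then have "u \<in> pverts (H (x j))" "v \<in> pverts (H (x j))"
      using pair_wf_digraph.in_arcsD1[OF H] pair_wf_digraph.in_arcsD2[OF H] by blast+
    then show ?thesis using 1 only by blast
  next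
    case (2 j)
    then show ?thesis using only by blast
  qed
qed

theorem lemma4p7:
  fixes G :: "'a pair_pre_digraph" and H :: "'a \<Rightarrow> 'a pair_pre_digraph"
    and h :: nat and m :: "nat \<Rightarrow> nat"
    and x :: "nat \<Rightarrow> 'a" and y :: "nat \<Rightarrow> nat \<Rightarrow> 'a"
  assumes "pair_graph G"
    and "inj_on x {1..h}" and "pverts G = x ` {1..h}"
    and "\<And>i. i \<in> {1..h} \<Longrightarrow> 1 \<le> m i"
    and "inj_on (\<lambda>(i, j). y i j) (SIGMA i:{1..h}. {1..m i})"
    and "\<And>i j. i \<in> {1..h} \<Longrightarrow> j \<in> {1..m i} \<Longrightarrow> y i j \<notin> pverts G"
    and "\<And>i. i \<in> {1..h} \<Longrightarrow> pverts (H (x i)) = y i ` {1..m i}"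
    and "\<And>i. i \<in> {1..h} \<Longrightarrow> K\<^bsub>m i\<^esub> (with_proj (H (x i)))"
  defines "\<Gamma> \<equiv> del_verts (corona G H) ((\<lambda>i. y i (m i)) ` {1..h})"
    and "\<pi> \<equiv> (\<lambda>i. (pverts (H (x i)) \<union> {x i}) - {y i (m i)})"
  shows "clique_partition \<Gamma> {1..h} \<pi> \<and>
    whisker_vertices \<Gamma> {1..h} (\<lambda>i. y i (m i)) \<and>
    corona G H = clique_whiskered \<Gamma> {1..h} \<pi> (\<lambda>i. y i (m i))"
proof -
  let ?I = "{1..h}"
  let ?w = "\<lambda>i. y i (m i)"
  let ?W = "\<lambda>i. pverts (H (x i)) \<union> {x i}"
  have x: "bij_betw x ?I (pverts G)"
    using assms(2,3) by (simp add: bij_betw_def)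
  have new: "pverts (H (x i)) \<inter> pverts G = {}" if "i \<in> ?I" for i
    using assms(6)[OF that] assms(7)[OF that] by auto
  have disj: "disjoint_family_on (\<lambda>i. pverts (H (x i))) ?I"
    unfolding disjoint_family_on_def
  proof (intro ballI impI)
    fix i j assume ij: "i \<in> ?I" "j \<in> ?I" "i \<noteq> j"
    have "y i k \<noteq> y j l" if "k \<in> {1..m i}" "l \<in> {1..m j}" for k l
      using inj_onD[OF assms(5), of "(i, k)" "(j, l)"] ij that by auto
    then show "pverts (H (x i)) \<inter> pverts (H (x j)) = {}"
      using assms(7) ij by auto
  qed
  have w: "?w i \<in> pverts (H (x i))" if "i \<in> ?I" for i
    using assms(4,7)[OF that] by auto
  then have wW: "?w i \<in> ?W i" if "i \<in> ?I" for i
    using that by blast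
  have wfG: "pair_wf_digraph G"
    using assms(1) by (simp add: pair_graph_def pair_digraph_def pair_fin_digraph_def)
  have wfH: "pair_wf_digraph (H (x i))" if "i \<in> ?I" for i
    using pair_graphI_complete[OF assms(8)[OF that]]
    by (simp add: pair_graph_def pair_digraph_def pair_fin_digraph_def)
  have part: "clique_partition (corona G H) ?I ?W"
    using clique_partition_corona[where n = m, OF assms(1) x assms(8) new disj] .
  have wf: "parcs (corona G H) \<subseteq> pverts (corona G H) \<times> pverts (corona G H)"
    by (rule corona_arcs_in_verts[OF wfG]) (use wfH assms(3) in auto)
  have nbr: "v \<in> ?W i"
    if i: "i \<in> ?I" and arc: "(?w i, v) \<in> parcs (corona G H) \<or> (v, ?w i) \<in> parcs (corona G H)"
    for i v
    using wfH new by (rule corona_arcs_of_leaf[OF wfG _ assms(3) _ disj i w[OF i] arc])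
  have "corona G H = clique_whiskered \<Gamma> ?I \<pi> ?w"
    unfolding \<Gamma>_def \<pi>_def
    by (rule clique_whiskered_del_verts[OF part wf wW]) (use nbr in auto)
  moreover have "whisker_vertices \<Gamma> ?I ?w"
    unfolding \<Gamma>_def by (rule whisker_vertices_del_verts[OF part wW])
  moreover have "clique_partition \<Gamma> ?I \<pi>"
  proof -
    \<comment> \<open>By disjointness, deleting all whisker vertices removes only \<open>?w i\<close> from the \<open>i\<close>-th clique.\<close>
    have "?W i - ?w ` ?I = \<pi> i" if i: "i \<in> ?I" for i
    proof -
      have "?w j \<notin> ?W i" if "j \<in> ?I" "j \<noteq> i" for j
        using part wW[OF that(1)] that i
        unfolding clique_partition_def disjoint_family_on_def by blast
      then show ?thesis
        using i unfolding \<pi>_def by blast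
    qed
    then show ?thesis
      using clique_partition_del_verts[OF part, of "?w ` ?I"]
      unfolding \<Gamma>_def clique_partition_def disjoint_family_on_def by simp
  qed
  ultimately show ?thesis by blast
qed

end
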